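(* Let $n\ge4$, let $\alpha_3,\dots,\alpha_{n-1}\in\mathbb{C}$, and let $(\mathfrak{s}^{4}_{n,1}(\alpha_3,\dots,\alpha_{n-1}),\cdot,[-,-])$ be a transposed Poisson algebra structure on the Lie algebra $\mathfrak{s}^{4}_{n,1}(\alpha_3,\dots,\alpha_{n-1})$. Then there are complex numbers $\beta_4,\dots,\beta_n,\gamma_1,\gamma_2$ such that the multiplication $\cdot$ is given by $$e_1\cdot e_1=\sum_{t=4}^n\beta_te_t,\qquad e_1\cdot x=\sum_{t=3}^{n-1}\Big(\beta_{t+1}+\sum_{r=3}^{t-2}\alpha_r\beta_{t-r+2}\Big)e_t+\gamma_1e_n,$$ $$x\cdot x=\sum_{i=2}^{n-2}\Big(\beta_{i+2}+\sum_{j=3}^{i-1}\alpha_j\Big(2\beta_{i-j+3}+\sum_{r=3}^{i-j}\alpha_r\beta_{i-j-r+4}\Big)\Big)e_i+\Big(\gamma_1+\sum_{i=3}^{n-2}\alpha_i\Big(\beta_{n-i+2}+\sum_{r=3}^{n-i-1}\alpha_r\beta_{n-i-r+3}\Big)\Big)e_{n-1}+\gamma_2e_n,$$ where products of basis elements that are not listed (up to commutativity) are zero.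
   Context: All algebras are over $\mathbb{C}$; empty sums are zero. A transposed Poisson algebra is a vector space $\mathfrak{L}$ with bilinear operations $\cdot$ and $[-,-]$ such that $(\mathfrak{L},\cdot)$ is a commutative associative algebra, $(\mathfrak{L},[-,-])$ is a Lie algebra, and $2z\cdot[u,v]=[z\cdot u,v]+[u,z\cdot v]$ for all $u,v,z\in\mathfrak{L}$. A transposed Poisson structure on a Lie algebra $(\mathfrak{L},[-,-])$ is an operation $\cdot$ making $(\mathfrak{L},\cdot,[-,-])$ a transposed Poisson algebra. $\mathfrak{s}^{4}_{n,1}(\alpha_3,\dots,\alpha_{n-1})$ is the $(n+1)$-dimensional Lie algebra with basis $e_1,\dots,e_n,x$ and brackets $[e_i,e_1]=e_{i+1}$ for $2\le i\le n-1$; $[e_i,x]=e_i+\sum_{l=i+2}^{n}\alpha_{l+1-i}e_l$ for $2\le i\le n$; brackets of basis elements not determined by these and antisymmetry are zero. *)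

theory Defs
  imports Complex_Main
begin

locale complex_algebra = vector_space scale
  for scale :: "complex \<Rightarrow> 'a::ab_group_add \<Rightarrow> 'a"  (infixr "*s" 75) +
  fixes prd :: "'a \<Rightarrow> 'a \<Rightarrow> 'a"
  assumes linear_right: "Vector_Spaces.linear scale scale (\<lambda>v. prd u v)"
    and linear_left: "Vector_Spaces.linear scale scale (\<lambda>u. prd u v)"

locale comm_assoc_algebra = complex_algebra scale mul
  for scale :: "complex \<Rightarrow> 'a::ab_group_add \<Rightarrow> 'a"  (infixr "*s" 75)
    and mul :: "'a \<Rightarrow> 'a \<Rightarrow> 'a"  (infixl "\<cdot>" 70) +
  assumes mul_commute: "u \<cdot> v = v \<cdot> u"
    and mul_assoc: "(u \<cdot> v) \<cdot> w = u \<cdot> (v \<cdot> w)"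

locale lie_algebra = complex_algebra scale bracket
  for scale :: "complex \<Rightarrow> 'a::ab_group_add \<Rightarrow> 'a"  (infixr "*s" 75)
    and bracket :: "'a \<Rightarrow> 'a \<Rightarrow> 'a"  ("\<lbrakk>_, _\<rbrakk>") +
  assumes bracket_self: "\<lbrakk>u, u\<rbrakk> = 0"
    and jacobi: "\<lbrakk>u, \<lbrakk>v, w\<rbrakk>\<rbrakk> + \<lbrakk>v, \<lbrakk>w, u\<rbrakk>\<rbrakk> + \<lbrakk>w, \<lbrakk>u, v\<rbrakk>\<rbrakk> = 0"

locale transposed_poisson_algebra =
  comm_assoc_algebra scale mul + lie_algebra scale bracket
  for scale :: "complex \<Rightarrow> 'a::ab_group_add \<Rightarrow> 'a"  (infixr "*s" 75)
    and mul :: "'a \<Rightarrow> 'a \<Rightarrow> 'a"  (infixl "\<cdot>" 70)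
    and bracket :: "'a \<Rightarrow> 'a \<Rightarrow> 'a"  ("\<lbrakk>_, _\<rbrakk>") +
  assumes transposed_leibniz: "2 *s (z \<cdot> \<lbrakk>u, v\<rbrakk>) = \<lbrakk>z \<cdot> u, v\<rbrakk> + \<lbrakk>u, z \<cdot> v\<rbrakk>"

text \<open>
  The Lie algebra \<open>s\<^sup>4\<^bsub>n,1\<^esub>(\<alpha>\<^sub>3, \<dots>, \<alpha>\<^bsub>n-1\<^esub>)\<close> with its distinguished basis
  \<open>e 1, \<dots>, e n, x\<close>. Only the values \<open>\<alpha> 3, \<dots>, \<alpha> (n - 1)\<close> and \<open>e 1, \<dots>, e n\<close> matter.
  The injectivity and non-membership conditions make the \<open>n + 1\<close> listed basis vectors
  distinct. All brackets of basis elements are fixed by the equations below together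
  with antisymmetry.
\<close>

locale s4_lie_algebra = lie_algebra scale bracket
  for scale :: "complex \<Rightarrow> 'a::ab_group_add \<Rightarrow> 'a"  (infixr "*s" 75)
    and bracket :: "'a \<Rightarrow> 'a \<Rightarrow> 'a"  ("\<lbrakk>_, _\<rbrakk>") +
  fixes n :: nat and \<alpha> :: "nat \<Rightarrow> complex" and e :: "nat \<Rightarrow> 'a" and x :: 'a
  assumes basis_inj: "inj_on e {1..n}"
    and basis_x: "x \<notin> e ` {1..n}"
    and basis_independent: "independent (insert x (e ` {1..n}))"
    and basis_span: "span (insert x (e ` {1..n})) = UNIV"
    and bracket_e_e1: "\<And>i. 2 \<le> i \<Longrightarrow> i \<le> n - 1 \<Longrightarrow> \<lbrakk>e i, e 1\<rbrakk> = e (i + 1)"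
    and bracket_en_e1: "\<lbrakk>e n, e 1\<rbrakk> = 0"
    and bracket_e_e: "\<And>i j. i \<in> {2..n} \<Longrightarrow> j \<in> {2..n} \<Longrightarrow> \<lbrakk>e i, e j\<rbrakk> = 0"
    and bracket_e_x: "\<And>i. 2 \<le> i \<Longrightarrow> i \<le> n \<Longrightarrow>
          \<lbrakk>e i, x\<rbrakk> = e i + (\<Sum>l=i+2..n. \<alpha> (l + 1 - i) *s e l)"
    and bracket_e1_x: "\<lbrakk>e 1, x\<rbrakk> = 0"

end

theory Submission
  imports Defs "HOL-Computational_Algebra.Formal_Power_Series"
begin

text \<open>
  On the abelian ideal \<open>N\<close> spanned by \<open>e 2, \<dots>, e n\<close>, which is the power series ring modulo
  \<open>X\<^bsup>n-1\<^esup>\<close> (with \<open>e i\<close> standing for \<open>X\<^bsup>i-2\<^esup>\<close>), the right brackets with \<open>e 1\<close> and \<open>x\<close> are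
  multiplication by \<open>X\<close> and by a series \<open>A\<close> with constant term 1. The transposed Leibniz rule says
  that every multiplication operator is a half-derivation \<open>\<phi>\<close>. Writing \<open>c\<close>, \<open>d\<close> for the coordinates
  of \<open>\<phi> x\<close> at \<open>e 1\<close>, \<open>x\<close>, one gets \<open>2 \<phi> A - A \<phi> = d A + c X\<close> on \<open>N\<close>. As \<open>A\<close> is unipotent, this
  Sylvester equation has the unique solution \<open>\<phi> = d + c X A\<^bsup>-1\<^esup>\<close>, and the rule for \<open>e 1\<close> then forces
  \<open>c = 0\<close> and \<open>\<phi> \<equiv> d\<close> modulo \<open>N\<close>. Commutativity forces \<open>d = 0\<close>. What remains is the rule for
  \<open>[e 1, x] = 0\<close>, namely \<open>A (e 1 \<cdot> e 1) = X (e 1 \<cdot> x)\<close> and \<open>A (e 1 \<cdot> x) = X (x \<cdot> x)\<close> in \<open>N\<close>,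
  and its coefficients are the asserted formulas.
\<close>

unbundle fps_syntax

section \<open>Bilinear products and antisymmetry of the bracket\<close>

context complex_algebra
begin

lemma prd_bilinear:
  "prd (u + v) w = prd u w + prd v w" "prd w (u + v) = prd w u + prd w v"
  "prd (c *s u) w = c *s prd u w" "prd w (c *s u) = c *s prd w u"
  "prd (u - v) w = prd u w - prd v w" "prd w (u - v) = prd w u - prd w v"
  using module_hom.add[OF linear_left[unfolded linear_iff_module_hom]]
    module_hom.add[OF linear_right[unfolded linear_iff_module_hom]]
    module_hom.scale[OF linear_left[unfolded linear_iff_module_hom]]
    module_hom.scale[OF linear_right[unfolded linear_iff_module_hom]]
    module_hom.diff[OF linear_left[unfolded linear_iff_module_hom]]
    module_hom.diff[OF linear_right[unfolded linear_iff_module_hom]]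
  by auto

lemma prd_0 [simp]: "prd 0 w = 0" "prd w 0 = 0"
  using prd_bilinear(3)[of 0 0 w] prd_bilinear(4)[of w 0 0] by simp_all

end

lemma (in lie_algebra) bracket_antisym: "\<lbrakk>u, v\<rbrakk> = - \<lbrakk>v, u\<rbrakk>"
  using bracket_self[of "u + v"] bracket_self[of u] bracket_self[of v]
  by (simp add: prd_bilinear add_eq_0_iff2)

section \<open>The ideal N as truncated power series\<close>

context s4_lie_algebra
begin

text \<open>Coefficients from X^(n-1) on are discarded, so a series is only a representative of an
  element of N. Identities in N are therefore stated as equalities of \<open>ser\<close> values, not
  of series.\<close>

definition ser :: "complex fps \<Rightarrow> 'a" where
  "ser F = (\<Sum>i=2..n. (F $ (i - 2)) *s e i)"

text \<open>The series A. Putting l = i + k in \<open>bracket_e_x\<close> turns \<alpha> (l + 1 - i)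
  into \<alpha> (k + 1); the gap at k = 1 reflects that the sum there starts at l = i + 2.\<close>

definition symb :: "complex fps" where
  "symb = Abs_fps (\<lambda>k. if k = 0 then 1 else if k = 1 then 0 else \<alpha> (k + 1))"

lemma symb_nth: "symb $ 0 = 1" "symb $ Suc 0 = 0" "2 \<le> k \<Longrightarrow> symb $ k = \<alpha> (k + 1)"
  by (simp_all add: symb_def)

lemma ser_add: "ser (F + G) = ser F + ser G"
  by (simp add: ser_def scale_left_distrib sum.distrib)

lemma ser_scale: "ser (fps_const c * F) = c *s ser F"
  by (simp add: ser_def scale_sum_right)

lemma ser_diff: "ser (F - G) = ser F - ser G"
  by (simp add: ser_def scale_left_diff_distrib sum_subtractf)

lemma ser_0 [simp]: "ser 0 = 0"
  by (simp add: ser_def)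

lemma ser_X_power:
  assumes "2 \<le> i" "i \<le> n"
  shows "ser (fps_X ^ (i - 2)) = e i"
proof -
  have "ser (fps_X ^ (i - 2)) = (\<Sum>j=2..n. if j = i then e j else 0)"
    unfolding ser_def using assms by (intro sum.cong) (auto simp: fps_X_power_nth)
  then show ?thesis
    using assms by simp
qed

lemma ser_X_power_vanishes: "ser (fps_X ^ (n - 1) * F) = 0"
  unfolding ser_def by (intro sum.neutral) (auto simp: fps_X_power_mult_nth)

text \<open>The matrix of \<open>T\<close> on N is triangular and constant along diagonals, so
  exchanging the two sums produces a Cauchy product with \<open>U\<close>. Triangularity makes this
  compatible with truncation.\<close>

lemma linear_ser:
  assumes T: "Vector_Spaces.linear (*s) (*s) T"
    and Te: "\<And>i. 2 \<le> i \<Longrightarrow> i \<le> n \<Longrightarrow> T (e i) = (\<Sum>l=i..n. (U $ (l - i)) *s e l)"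
  shows "T (ser F) = ser (U * F)"
proof -
  interpret T: module_hom scale scale T
    using T by (simp add: linear_iff_module_hom)
  have "T (ser F) = (\<Sum>i=2..n. \<Sum>l=i..n. (F $ (i - 2) * U $ (l - i)) *s e l)"
    by (simp add: ser_def T.sum T.scale Te scale_sum_right)
  also have "\<dots> = (\<Sum>i=2..n. \<Sum>l=2..n. if i \<le> l then (F $ (i - 2) * U $ (l - i)) *s e l else 0)"
    by (intro sum.cong refl sum.mono_neutral_cong_left) auto
  also have "\<dots> = (\<Sum>l=2..n. \<Sum>i=2..n. if i \<le> l then (F $ (i - 2) * U $ (l - i)) *s e l else 0)"
    by (rule sum.swap)
  also have "\<dots> = (\<Sum>l=2..n. \<Sum>i=2..l. (F $ (i - 2) * U $ (l - i)) *s e l)"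
    by (intro sum.cong refl sum.mono_neutral_cong_right) auto
  also have "\<dots> = (\<Sum>l=2..n. ((F * U) $ (l - 2)) *s e l)"
  proof (intro sum.cong refl)
    fix l assume l: "l \<in> {2..n}"
    then obtain m where m: "l = m + 2"
      by (metis atLeastAtMost_iff le_add_diff_inverse2)
    have "(\<Sum>i=2..l. F $ (i - 2) * U $ (l - i)) = (\<Sum>i=0..m. F $ i * U $ (m - i))"
      using sum.shift_bounds_cl_nat_ivl[of "\<lambda>i. F $ (i - 2) * U $ (l - i)" 0 2 m]
      by (simp add: m numeral_2_eq_2 del: sum.cl_ivl_Suc)
    then show "(\<Sum>i=2..l. (F $ (i - 2) * U $ (l - i)) *s e l) = ((F * U) $ (l - 2)) *s e l"
      by (simp add: fps_mult_nth m flip: scale_sum_left)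
  qed
  finally show ?thesis
    by (simp add: ser_def mult.commute)
qed

lemma bracket_ser_e1: "\<lbrakk>ser F, e 1\<rbrakk> = ser (fps_X * F)"
proof (rule linear_ser[OF linear_left])
  fix i assume i: "2 \<le> i" "i \<le> n"
  have "(\<Sum>l=i..n. (fps_X $ (l - i)) *s e l) = (\<Sum>l=i..n. if l = i + 1 then e l else 0)"
    by (intro sum.cong) auto
  also have "\<dots> = \<lbrakk>e i, e 1\<rbrakk>"
    using i bracket_e_e1[of i] bracket_en_e1 by (cases "i = n") auto
  finally show "\<lbrakk>e i, e 1\<rbrakk> = (\<Sum>l=i..n. (fps_X $ (l - i)) *s e l)" ..
qed

lemma bracket_ser_x: "\<lbrakk>ser F, x\<rbrakk> = ser (symb * F)"
proof (rule linear_ser[OF linear_left])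
  fix i assume i: "2 \<le> i" "i \<le> n"
  have "(\<Sum>l=i..n. (symb $ (l - i)) *s e l) = e i + (\<Sum>l=Suc i..n. (symb $ (l - i)) *s e l)"
    using i by (subst sum.atLeast_Suc_atMost) (auto simp: symb_nth)
  also have "(\<Sum>l=Suc i..n. (symb $ (l - i)) *s e l) = (\<Sum>l=i+2..n. \<alpha> (l + 1 - i) *s e l)"
  proof (rule sum.mono_neutral_cong_right)
    show "\<forall>l\<in>{Suc i..n} - {i+2..n}. (symb $ (l - i)) *s e l = 0"
    proof
      fix l assume "l \<in> {Suc i..n} - {i+2..n}"
      then have "l - i = Suc 0" by auto
      then show "(symb $ (l - i)) *s e l = 0" by (simp add: symb_nth)
    qed
  qed (auto simp: symb_nth Suc_diff_le)
  finally show "\<lbrakk>e i, x\<rbrakk> = (\<Sum>l=i..n. (symb $ (l - i)) *s e l)"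
    using bracket_e_x[OF i] by simp
qed

lemma bracket_ser_ser: "\<lbrakk>ser F, ser G\<rbrakk> = 0"
proof -
  have 1: "\<lbrakk>e i, ser G\<rbrakk> = 0" if "i \<in> {2..n}" for i
    unfolding ser_def
    using that by (simp add: module_hom.sum[OF linear_right[unfolded linear_iff_module_hom]]
        prd_bilinear bracket_e_e)
  show ?thesis
    unfolding ser_def[of F]
    by (simp add: module_hom.sum[OF linear_left[unfolded linear_iff_module_hom]]
        prd_bilinear 1)
qed

section \<open>Coordinates in the basis and the kernel of \<open>ser\<close>\<close>

lemma basis_eq: "n \<ge> 1 \<Longrightarrow> insert x (e ` {1..n}) = insert x (insert (e 1) (e ` {2..n}))"
proof -
  assume "n \<ge> 1"
  then have "{1..n} = insert 1 {2..n}" by auto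
  then show ?thesis by simp
qed

lemma decomposition:
  assumes "n \<ge> 1"
  obtains a b F where "v = a *s e 1 + b *s x + ser F"
proof -
  have ran: "\<exists>F. w = ser F" if "w \<in> span (e ` {2..n})" for w
    using that
  proof (induction rule: span_induct_alt)
    case base
    show ?case by (metis ser_0)
  next
    case (step c y z)
    then obtain i F where "i \<in> {2..n}" "y = e i" "z = ser F" by auto
    then have "c *s y + z = ser (fps_const c * fps_X ^ (i - 2) + F)"
      by (simp add: ser_add ser_scale ser_X_power)
    then show ?case by blast
  qed
  have "v \<in> span (insert x (insert (e 1) (e ` {2..n})))"
    using basis_span basis_eq[OF assms] by auto
  then obtain b a where "v - b *s x - a *s e 1 \<in> span (e ` {2..n})"
    by (auto simp: span_breakdown_eq)
  then obtain F where "v - b *s x - a *s e 1 = ser F"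
    using ran by blast
  then have "v = a *s e 1 + b *s x + ser F"
    by (simp add: algebra_simps)
  then show thesis ..
qed

lemma coordinates_eq_0:
  assumes "n \<ge> 1" "a *s e 1 + b *s x + ser F = 0"
  shows "a = 0" "b = 0" "k < n - 1 \<Longrightarrow> F $ k = 0"
proof -
  define c where "c i = (if i = 1 then a else F $ (i - 2))" for i
  \<comment> \<open>Independence concerns coefficients attached to vectors, so the indexed family
    \<open>c\<close> is carried over along the inverse of \<open>e\<close>.\<close>
  define u where "u v = (if v = x then b else c (the_inv_into {1..n} e v))" for v
  have u: "u (e i) = c i" if "i \<in> {1..n}" for i
    using that basis_x by (auto simp: u_def the_inv_into_f_f[OF basis_inj[unfolded One_nat_def]])
  have "(\<Sum>v\<in>insert x (e ` {1..n}). u v *s v) = b *s x + (\<Sum>i=1..n. u (e i) *s e i)"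
    using basis_x by (simp add: u_def sum.reindex[OF basis_inj[unfolded One_nat_def]])
  also have "(\<Sum>i=1..n. u (e i) *s e i) = (\<Sum>i=1..n. c i *s e i)"
    by (intro sum.cong) (auto simp: u)
  also have "\<dots> = a *s e 1 + (\<Sum>i=2..n. c i *s e i)"
    using assms(1) by (subst sum.atLeast_Suc_atMost) (auto simp: c_def numeral_2_eq_2)
  also have "(\<Sum>i=2..n. c i *s e i) = ser F"
    unfolding ser_def by (intro sum.cong) (auto simp: c_def)
  also have "b *s x + (a *s e 1 + ser F) = 0"
    using assms(2) by (simp add: algebra_simps)
  finally have z: "u v = 0" if "v \<in> insert x (e ` {1..n})" for v
    using independentD[OF basis_independent _ subset_refl] that by simp
  show "b = 0"
    using z[of x] by (simp add: u_def)
  have c0: "c i = 0" if "i \<in> {1..n}" for i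
    using u[OF that] z[of "e i"] that by auto
  show "a = 0"
    using c0[of 1] assms(1) by (simp add: c_def)
  show "F $ k = 0" if "k < n - 1"
    using c0[of "k + 2"] that by (simp add: c_def)
qed

lemma ser_eq_0_iff: "n \<ge> 1 \<Longrightarrow> ser F = 0 \<longleftrightarrow> (\<forall>k < n - 1. F $ k = 0)"
  using coordinates_eq_0(3)[of 0 0 F] by (auto simp: ser_def intro!: sum.neutral)

lemma ser_eq_iff: "n \<ge> 1 \<Longrightarrow> ser F = ser G \<longleftrightarrow> (\<forall>k < n - 1. F $ k = G $ k)"
  using ser_eq_0_iff[of "F - G"] by (simp add: ser_diff)

section \<open>Arithmetic modulo X^(n-1), the Sylvester equation and half-derivations\<close>

lemma ser_mult_eq_0:
  assumes "n \<ge> 1" "ser F = 0"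
  shows "ser (U * F) = 0"
  using assms by (simp add: ser_eq_0_iff fps_mult_nth)

text \<open>The kernel of \<open>ser\<close> is an ideal, and a series with nonzero constant term is
  invertible, so such a factor can be cancelled.\<close>

lemma ser_unit_mult_eq_0:
  assumes "n \<ge> 1" "ser (U * F) = 0" "U $ 0 \<noteq> 0"
  shows "ser F = 0"
proof -
  have "inverse U * (U * F) = F"
    using assms(3) by (simp add: inverse_mult_eq_1 flip: mult.assoc)
  then show ?thesis
    using ser_mult_eq_0[OF assms(1,2), of "inverse U"] by (simp only:)
qed

lemma ser_mult_cong: "n \<ge> 1 \<Longrightarrow> ser F = ser G \<Longrightarrow> ser (U * F) = ser (U * G)"
  using ser_mult_eq_0[of "F - G" U] by (simp add: ser_diff right_diff_distrib)

text \<open>Descending induction on k shows that \<Psi> vanishes on multiples of X^k, starting from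
  X^(n-1). Since A = 1 + X Q, the series A X^k F and X^k F differ by a multiple of X^(k+1), which
  the induction hypothesis removes. This leaves (2 - A) \<Psi> = 0 on X^k F, and 2 - A has constant
  term 1.\<close>

lemma sylvester_eq_0:
  assumes n: "n \<ge> 1"
    and \<Psi>_add: "\<And>F G. ser (\<Psi> (F + G)) = ser (\<Psi> F) + ser (\<Psi> G)"
    and \<Psi>_0: "\<And>F. ser F = 0 \<Longrightarrow> ser (\<Psi> F) = 0"
    and \<Psi>: "\<And>F. 2 *s ser (\<Psi> (symb * F)) = ser (symb * \<Psi> F)"
  shows "ser (\<Psi> F) = 0"
proof -
  obtain Q where Q: "symb = 1 + fps_X * Q"
  proof
    show "symb = 1 + fps_X * Abs_fps (\<lambda>k. symb $ Suc k)"
      by (rule fps_ext) (auto simp: symb_nth gr0_conv_Suc)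
  qed
  have "ser (\<Psi> (fps_X ^ k * F)) = 0" if "k \<le> n - 1" for k F
    using that
  proof (induction arbitrary: F rule: inc_induct)
    case base
    show ?case
      by (rule \<Psi>_0[OF ser_X_power_vanishes])
  next
    case (step k)
    let ?F = "fps_X ^ k * F"
    have "symb * ?F = ?F + fps_X ^ Suc k * (Q * F)"
      by (simp add: Q algebra_simps)
    then have "ser (\<Psi> (symb * ?F)) = ser (\<Psi> ?F)"
      using step.IH[of "Q * F"] \<Psi>_add by simp
    then have "ser (fps_const 2 * \<Psi> ?F - symb * \<Psi> ?F) = 0"
      using \<Psi>[of ?F] by (simp only: ser_diff ser_scale) simp
    then have "ser ((fps_const 2 - symb) * \<Psi> ?F) = 0"
      by (simp add: left_diff_distrib)
    then show ?case
      using ser_unit_mult_eq_0[OF n] by (simp add: symb_nth)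
  qed
  from this[of 0 F] show ?thesis by simp
qed

lemma half_derivation:
  assumes n: "n \<ge> 4"
    and lin: "Vector_Spaces.linear (*s) (*s) \<phi>"
    and half: "\<And>u v. 2 *s \<phi> \<lbrakk>u, v\<rbrakk> = \<lbrakk>\<phi> u, v\<rbrakk> + \<lbrakk>u, \<phi> v\<rbrakk>"
  obtains d G H where "\<And>F. \<phi> (ser F) = d *s ser F"
    and "\<phi> (e 1) = d *s e 1 + ser G" and "\<phi> x = d *s x + ser H"
proof -
  interpret \<phi>: module_hom scale scale \<phi>
    using lin by (simp add: linear_iff_module_hom)
  have n1: "n \<ge> 1" using n by simp
  obtain a b G where \<phi>e1: "\<phi> (e 1) = a *s e 1 + b *s x + ser G"
    by (rule decomposition[OF n1])
  obtain c d H where \<phi>x: "\<phi> x = c *s e 1 + d *s x + ser H"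
    by (rule decomposition[OF n1])
  have half_x: "2 *s \<phi> (ser (symb * F)) = \<lbrakk>\<phi> (ser F), x\<rbrakk>
      + ser (fps_const c * fps_X * F + fps_const d * symb * F)" for F
    using half[of "ser F" x]
    by (simp add: \<phi>x prd_bilinear bracket_ser_x bracket_ser_e1[unfolded One_nat_def]
        bracket_ser_ser ser_add ser_scale mult.assoc)
  have half_e1: "2 *s \<phi> (ser (fps_X * F)) = \<lbrakk>\<phi> (ser F), e 1\<rbrakk>
      + ser (fps_const a * fps_X * F + fps_const b * symb * F)" for F
    using half[of "ser F" "e 1"]
    by (simp add: \<phi>e1[unfolded One_nat_def] prd_bilinear bracket_ser_x
        bracket_ser_e1[unfolded One_nat_def] bracket_ser_ser ser_add ser_scale mult.assoc)
  \<comment> \<open>\<phi> preserves N: each F is A times another series, so \<open>half_x\<close>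
    writes 2 \<phi> (ser F) as a bracket with x plus an element of N. Brackets with x lie in N
    because [e 1, x] = [x, x] = 0.\<close>
  have "\<exists>K. \<phi> (ser F) = ser K" for F
  proof -
    obtain p q M where M: "\<phi> (ser (inverse symb * F)) = p *s e 1 + q *s x + ser M"
      by (rule decomposition[OF n1])
    have "\<lbrakk>x, x\<rbrakk> = 0" "\<lbrakk>e 1, x\<rbrakk> = 0"
      using bracket_self bracket_e1_x by auto
    then have "\<lbrakk>\<phi> (ser (inverse symb * F)), x\<rbrakk> = ser (symb * M)"
      by (simp add: M prd_bilinear bracket_ser_x)
    moreover have "symb * (inverse symb * F) = F"
      by (simp add: inverse_mult_eq_1' symb_nth flip: mult.assoc)
    ultimately obtain K where "2 *s \<phi> (ser F) = ser K"
      using half_x[of "inverse symb * F"] by (metis ser_add)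
    then have "\<phi> (ser F) = ser (fps_const (1/2) * K)"
      by (simp only: ser_scale flip: \<open>2 *s \<phi> (ser F) = ser K\<close>) simp
    then show ?thesis ..
  qed
  \<comment> \<open>\<Phi> chooses representatives, so it is additive only after applying
    \<open>ser\<close>.\<close>
  then obtain \<Phi> where \<Phi>: "\<And>F. \<phi> (ser F) = ser (\<Phi> F)"
    by metis
  \<comment> \<open>The defect of the expected solution d + c X A^(-1), multiplied by A to avoid the
    inverse. It satisfies the homogeneous Sylvester equation.\<close>
  define \<Psi> where "\<Psi> F = symb * \<Phi> F - (fps_const d * symb + fps_const c * fps_X) * F" for F
  have \<Phi>_add: "ser (\<Phi> (F + G)) = ser (\<Phi> F) + ser (\<Phi> G)" for F G
    by (simp add: ser_add \<phi>.add flip: \<Phi>)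
  have \<Phi>_x: "ser (fps_const 2 * \<Phi> (symb * F))
      = ser (symb * \<Phi> F + (fps_const d * symb + fps_const c * fps_X) * F)" for F
    using half_x[of F] by (simp add: \<Phi> bracket_ser_x ser_add ser_scale algebra_simps)
  have \<Phi>_e1: "ser (fps_const 2 * \<Phi> (fps_X * F))
      = ser (fps_X * \<Phi> F + (fps_const a * fps_X + fps_const b * symb) * F)" for F
    using half_e1[of F]
    by (simp add: \<Phi> bracket_ser_e1[unfolded One_nat_def] ser_add ser_scale algebra_simps)
  let ?W = "fps_const d * symb + fps_const c * fps_X"
  have "ser (\<Psi> F) = 0" for F
  proof (rule sylvester_eq_0[OF n1, where \<Psi> = \<Psi>])
    fix F G
    have "ser (symb * \<Phi> (F + G)) = ser (symb * (\<Phi> F + \<Phi> G))"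
      by (rule ser_mult_cong[OF n1]) (simp add: \<Phi>_add ser_add)
    then show "ser (\<Psi> (F + G)) = ser (\<Psi> F) + ser (\<Psi> G)"
      by (simp add: \<Psi>_def ser_add ser_diff algebra_simps)
  next
    fix F assume "ser F = 0"
    then have "ser (\<Phi> F) = 0"
      by (simp flip: \<Phi>)
    then show "ser (\<Psi> F) = 0"
      using \<open>ser F = 0\<close> by (simp add: \<Psi>_def ser_diff ser_mult_eq_0[OF n1])
  next
    fix F
    have two: "fps_const 2 = (1 + 1 :: complex fps)"
      by (simp add: numeral_fps_const)
    have "2 *s ser (\<Psi> (symb * F))
        = ser (symb * (fps_const 2 * \<Phi> (symb * F))) - ser (fps_const 2 * (?W * (symb * F)))"
      by (simp add: \<Psi>_def algebra_simps flip: ser_scale ser_diff)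
    also have "ser (symb * (fps_const 2 * \<Phi> (symb * F))) = ser (symb * (symb * \<Phi> F + ?W * F))"
      by (rule ser_mult_cong[OF n1 \<Phi>_x])
    also have "\<dots> - ser (fps_const 2 * (?W * (symb * F))) = ser (symb * \<Psi> F)"
      unfolding ser_diff[symmetric] two by (simp add: \<Psi>_def algebra_simps)
    finally show "2 *s ser (\<Psi> (symb * F)) = ser (symb * \<Psi> F)" .
  qed
  then have sol: "ser (symb * \<Phi> F) = ser (?W * F)" for F
    by (simp add: \<Psi>_def ser_diff)
  \<comment> \<open>The rule for e 1 is evaluated at F = 1, that is at e 2. Multiplying by A lets
    \<open>sol\<close> eliminate \<Phi> on both sides, leaving X W = A (a X + b A) modulo X^(n-1),
    with W = d A + c X.\<close>
  have "ser (fps_const 2 * (?W * fps_X)) = ser (symb * (fps_const 2 * \<Phi> (fps_X * 1)))"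
    using ser_mult_cong[OF n1 sol[of "fps_X * 1"], of "fps_const 2"]
    by (simp add: mult.left_commute)
  also have "\<dots> = ser (symb * (fps_X * \<Phi> 1 + (fps_const a * fps_X + fps_const b * symb) * 1))"
    by (rule ser_mult_cong[OF n1 \<Phi>_e1])
  also have "\<dots> = ser (fps_X * (symb * \<Phi> 1)) + ser (symb * (fps_const a * fps_X + fps_const b * symb))"
    by (simp add: algebra_simps flip: ser_add)
  also have "ser (fps_X * (symb * \<Phi> 1)) = ser (fps_X * (?W * 1))"
    by (rule ser_mult_cong[OF n1 sol])
  finally have key: "(fps_const 2 * (?W * fps_X)) $ k
      = (fps_X * ?W + symb * (fps_const a * fps_X + fps_const b * symb)) $ k" if "k < n - 1" for k
    using that n1 by (simp add: ser_eq_iff flip: ser_add)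
  \<comment> \<open>Coefficients 0, 1 and 2 give b, a - d and c in turn; A has no linear term, and n
    \<ge> 4 puts index 2 below the truncation.\<close>
  have "b = 0"
    using key[of 0] n by (simp add: symb_nth)
  have "a = d"
    using key[of 1] n \<open>b = 0\<close> by (simp add: symb_nth fps_mult_nth)
  have "c = 0"
    using key[of 2] n \<open>b = 0\<close> by (simp add: symb_nth fps_mult_nth numeral_2_eq_2)
  have "ser (\<Phi> F) = ser (fps_const d * F)" for F
  proof -
    have "ser (symb * (\<Phi> F - fps_const d * F)) = 0"
      using sol[of F] \<open>c = 0\<close> by (simp add: right_diff_distrib ser_diff algebra_simps)
    then have "ser (\<Phi> F - fps_const d * F) = 0"
      by (rule ser_unit_mult_eq_0[OF n1]) (simp add: symb_nth)
    then show ?thesis by (simp add: ser_diff)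
  qed
  then show thesis
    using that[of d G H] \<phi>e1 \<phi>x \<open>a = d\<close> \<open>b = 0\<close> \<open>c = 0\<close> by (simp add: \<Phi> ser_scale)
qed

section \<open>Coefficient formulas for the products\<close>

lemma symb_mult_nth:
  assumes "F $ 0 = 0"
  shows "(symb * F) $ k = F $ k + (\<Sum>r=3..k. \<alpha> r * F $ (k + 1 - r))"
proof -
  have "(symb * F) $ k = (\<Sum>j=0..k. symb $ j * F $ (k - j))"
    by (rule fps_mult_nth)
  also have "\<dots> = F $ k + (\<Sum>j=Suc 0..k. symb $ j * F $ (k - j))"
    by (subst sum.atLeast_Suc_atMost) (auto simp: symb_nth)
  \<comment> \<open>The term j = 1 drops since A has no linear term, and j = k since F has no
    constant term. This is why r = j + 1 stops at k.\<close>
  also have "(\<Sum>j=Suc 0..k. symb $ j * F $ (k - j)) = (\<Sum>j\<in>{2..<k}. symb $ j * F $ (k - j))"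
    by (rule sum.mono_neutral_right)
      (auto simp: symb_nth assms not_le not_less less_Suc_eq numeral_2_eq_2 dest!: le_antisym[rotated])
  also have "\<dots> = (\<Sum>r=3..k. \<alpha> r * F $ (k + 1 - r))"
    by (rule sum.reindex_bij_witness[of _ "\<lambda>r. r - 1" "\<lambda>j. j + 1"]) (auto simp: symb_nth)
  finally show ?thesis .
qed

end

theorem theorem3p5:
  fixes scale :: "complex \<Rightarrow> 'a::ab_group_add \<Rightarrow> 'a"  (infixr "*s" 75)
    and mul :: "'a \<Rightarrow> 'a \<Rightarrow> 'a"  (infixl "\<cdot>" 70)
    and bracket :: "'a \<Rightarrow> 'a \<Rightarrow> 'a"
    and n :: nat and \<alpha> :: "nat \<Rightarrow> complex" and e :: "nat \<Rightarrow> 'a" and x :: 'a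
  assumes "n \<ge> 4"
    and "s4_lie_algebra scale bracket n \<alpha> e x"
    and "transposed_poisson_algebra scale mul bracket"
  shows "\<exists>(\<beta> :: nat \<Rightarrow> complex) (\<gamma>\<^sub>1 :: complex) (\<gamma>\<^sub>2 :: complex).
      e 1 \<cdot> e 1 = (\<Sum>t=4..n. \<beta> t *s e t)
    \<and> e 1 \<cdot> x = (\<Sum>t=3..n-1. (\<beta> (t + 1) + (\<Sum>r=3..t-2. \<alpha> r * \<beta> (t - r + 2))) *s e t)
          + \<gamma>\<^sub>1 *s e n
    \<and> x \<cdot> x = (\<Sum>i=2..n-2. (\<beta> (i + 2)
              + (\<Sum>j=3..i-1. \<alpha> j * (2 * \<beta> (i - j + 3)
                    + (\<Sum>r=3..i-j. \<alpha> r * \<beta> (i - j - r + 4))))) *s e i)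
          + (\<gamma>\<^sub>1 + (\<Sum>i=3..n-2. \<alpha> i * (\<beta> (n - i + 2)
                    + (\<Sum>r=3..n-i-1. \<alpha> r * \<beta> (n - i - r + 3))))) *s e (n - 1)
          + \<gamma>\<^sub>2 *s e n
    \<and> (\<forall>i\<in>{1..n}. \<forall>j\<in>{1..n}. (i, j) \<noteq> (1, 1) \<longrightarrow> e i \<cdot> e j = 0)
    \<and> (\<forall>i\<in>{2..n}. e i \<cdot> x = 0)"
proof -
  interpret S: s4_lie_algebra scale bracket n \<alpha> e x by fact
  interpret T: transposed_poisson_algebra scale mul bracket by fact
  have n1: "n \<ge> 1" using assms(1) by simp
  have "\<exists>d G H. (\<forall>F. z \<cdot> S.ser F = d *s S.ser F) \<and> z \<cdot> e 1 = d *s e 1 + S.ser G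
      \<and> z \<cdot> x = d *s x + S.ser H" for z
    using S.half_derivation[OF assms(1) T.linear_right T.transposed_leibniz] by metis
  then obtain d G H where ser: "\<And>z F. z \<cdot> S.ser F = d z *s S.ser F"
    and e1: "\<And>z. z \<cdot> e 1 = d z *s e 1 + S.ser (G z)"
    and x: "\<And>z. z \<cdot> x = d z *s x + S.ser (H z)"
    by metis
  \<comment> \<open>Computed as x times \<open>ser F\<close>, the product lies in N; computed in the
    other order, its x-coordinate is d (ser F).\<close>
  have d_ser: "d (S.ser F) = 0" for F
  proof (rule S.coordinates_eq_0(2)[OF n1])
    show "0 *s e 1 + d (S.ser F) *s x + S.ser (H (S.ser F) - fps_const (d x) * F) = 0"
      using x[of "S.ser F"] ser[of x F] T.mul_commute[of x "S.ser F"]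
      by (simp add: S.ser_diff S.ser_scale add_diff_eq)
  qed
  \<comment> \<open>The same comparison for e 1 and x: one order has only an e 1 part outside N, the
    other only an x part.\<close>
  have "(- d x) *s e 1 + d (e 1) *s x + S.ser (H (e 1) - G x) = 0"
    using x[of "e 1"] e1[of x] T.mul_commute[of x "e 1"]
    by (simp add: S.ser_diff algebra_simps)
  then have d_e1: "d (e 1) = 0" and d_x: "d x = 0"
    using S.coordinates_eq_0(1,2)[OF n1] by (metis neg_equal_0_iff_equal)+
  have zero: "z \<cdot> S.ser F = 0" for z F
  proof -
    obtain a b K where "z = a *s e 1 + b *s x + S.ser K"
      by (rule S.decomposition[OF n1])
    then have "z \<cdot> S.ser F = a *s (e 1 \<cdot> S.ser F) + b *s (x \<cdot> S.ser F) + S.ser K \<cdot> S.ser F"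
      by (simp only: T.prd_bilinear)
    also have "\<dots> = 0"
      unfolding ser d_ser d_e1 d_x by simp
    finally show ?thesis .
  qed
  obtain B where B: "e 1 \<cdot> e 1 = S.ser B"
    using e1[of "e 1"] d_e1 by simp
  obtain C where C: "e 1 \<cdot> x = S.ser C"
    using x[of "e 1"] d_e1 by simp
  obtain K where K: "x \<cdot> x = S.ser K"
    using x[of x] d_x by simp
  \<comment> \<open>The transposed Leibniz rule applied to [e 1, x] = 0. Taking z = e 1 and z = x
    yields A B = X C and A C = X K in N.\<close>
  have e1_x: "bracket (z \<cdot> e 1) x = bracket (z \<cdot> x) (e 1)" for z
    using T.transposed_leibniz[of z "e 1" x] S.bracket_e1_x S.bracket_antisym[of "e 1" "z \<cdot> x"]
    by simp
  have BC: "(S.symb * B) $ k = (fps_X * C) $ k" if "k < n - 1" for k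
  proof -
    have "S.ser (S.symb * B) = S.ser (fps_X * C)"
      using e1_x[of "e 1"] unfolding B C S.bracket_ser_e1 S.bracket_ser_x .
    then show ?thesis
      using that by (simp add: S.ser_eq_iff[OF n1])
  qed
  have CK: "(S.symb * C) $ k = (fps_X * K) $ k" if "k < n - 1" for k
  proof -
    have "S.ser (S.symb * C) = S.ser (fps_X * K)"
      using e1_x[of x] unfolding T.mul_commute[of x "e 1"] C K S.bracket_ser_e1 S.bracket_ser_x .
    then show ?thesis
      using that by (simp add: S.ser_eq_iff[OF n1])
  qed
  \<comment> \<open>The lowest coefficients of the two equations explain why e 1 \<cdot> e 1 starts
    at e 4 and e 1 \<cdot> x at e 3.\<close>
  have B0: "B $ 0 = 0"
    using BC[of 0] assms(1) by (simp add: S.symb_nth)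
  have C0: "C $ 0 = 0"
    using CK[of 0] assms(1) by (simp add: S.symb_nth)
  have B1: "B $ Suc 0 = 0"
    using BC[of 1] assms(1) B0 C0 by (simp add: S.symb_nth)
  define \<beta> where "\<beta> t = B $ (t - 2)" for t
  define c where "c t = \<beta> (t + 1) + (\<Sum>r=3..t-2. \<alpha> r * \<beta> (t - r + 2))" for t
  \<comment> \<open>This and \<open>c_plus_1\<close> only normalise truncated subtraction, which is
    harmless because r \<le> m in the sums.\<close>
  have c_plus_2: "c (m + 2) = \<beta> (m + 3) + (\<Sum>r=3..m. \<alpha> r * \<beta> (m - r + 4))" for m
  proof -
    have "(\<Sum>r=3..m. \<alpha> r * \<beta> (m + 2 - r + 2)) = (\<Sum>r=3..m. \<alpha> r * \<beta> (m - r + 4))"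
    proof (intro sum.cong refl)
      fix r assume "r \<in> {3..m}"
      then have "m + 2 - r + 2 = m - r + 4" by auto
      then show "\<alpha> r * \<beta> (m + 2 - r + 2) = \<alpha> r * \<beta> (m - r + 4)" by (simp only:)
    qed
    then show ?thesis
      by (simp add: c_def numeral_3_eq_3)
  qed
  have c_plus_1: "c (m + 1) = \<beta> (m + 2) + (\<Sum>r=3..m-1. \<alpha> r * \<beta> (m - r + 3))" for m
  proof -
    have "(\<Sum>r=3..m-1. \<alpha> r * \<beta> (m + 1 - r + 2)) = (\<Sum>r=3..m-1. \<alpha> r * \<beta> (m - r + 3))"
    proof (intro sum.cong refl)
      fix r assume "r \<in> {3..m-1}"
      then have "m + 1 - r + 2 = m - r + 3" by auto
      then show "\<alpha> r * \<beta> (m + 1 - r + 2) = \<alpha> r * \<beta> (m - r + 3)" by (simp only:)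
    qed
    then show ?thesis
      by (simp add: c_def numeral_2_eq_2)
  qed
  \<comment> \<open>Multiplication by X shifts indices by one, so the equations modulo X^(n-1) do
    not determine the coefficients of C and K at e n. These become \<open>\<gamma>\<^sub>1\<close>
    and \<open>\<gamma>\<^sub>2\<close>. The sum loses its term r = t - 1 because \<open>B1\<close>
    vanishes.\<close>
  have C_nth: "C $ (t - 2) = c t" if "3 \<le> t" "t \<le> n - 1" for t
  proof -
    have "C $ (t - 2) = (S.symb * B) $ (t - 1)"
      using BC[of "t - 1"] that by (simp add: numeral_2_eq_2)
    also have "\<dots> = B $ (t - 1) + (\<Sum>r=3..t-1. \<alpha> r * B $ (t - r))"
      using that by (simp add: S.symb_mult_nth[OF B0])
    also have "(\<Sum>r=3..t-1. \<alpha> r * B $ (t - r)) = (\<Sum>r=3..t-2. \<alpha> r * B $ (t - r))"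
    proof (rule sum.mono_neutral_right)
      show "\<forall>r\<in>{3..t-1} - {3..t-2}. \<alpha> r * B $ (t - r) = 0"
      proof
        fix r assume "r \<in> {3..t-1} - {3..t-2}"
        then have "t - r = Suc 0" by auto
        then show "\<alpha> r * B $ (t - r) = 0" by (simp add: B1)
      qed
    qed auto
    finally show ?thesis
      by (simp add: c_def \<beta>_def)
  qed
  \<comment> \<open>C $ (i - 1) is not replaced by c (i + 1): for i = n - 1 it is the free
    coefficient \<open>\<gamma>\<^sub>1\<close>. This is also why the e (n - 1) term of x \<cdot> x
    is split off below.\<close>
  have K_nth: "K $ (i - 2) = C $ (i - 1) + (\<Sum>j=3..i-1. \<alpha> j * c (i - j + 2))"
    if "2 \<le> i" "i \<le> n - 1" for i
  proof -
    have "K $ (i - 2) = (S.symb * C) $ (i - 1)"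
      using CK[of "i - 1"] that by (simp add: numeral_2_eq_2)
    also have "\<dots> = C $ (i - 1) + (\<Sum>j=3..i-1. \<alpha> j * C $ (i - j))"
      using that by (simp add: S.symb_mult_nth[OF C0])
    also have "(\<Sum>j=3..i-1. \<alpha> j * C $ (i - j)) = (\<Sum>j=3..i-1. \<alpha> j * c (i - j + 2))"
    proof (intro sum.cong refl)
      fix j assume "j \<in> {3..i-1}"
      then have "3 \<le> i - j + 2" "i - j + 2 \<le> n - 1"
        using that by auto
      then show "\<alpha> j * C $ (i - j) = \<alpha> j * c (i - j + 2)"
        using C_nth[of "i - j + 2"] by simp
    qed
    finally show ?thesis .
  qed
  have mul_e1_e1: "e 1 \<cdot> e 1 = (\<Sum>t=4..n. \<beta> t *s e t)"
    unfolding B S.ser_def \<beta>_def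
  proof (rule sum.mono_neutral_right)
    show "\<forall>i\<in>{2..n} - {4..n}. (B $ (i - 2)) *s e i = 0"
    proof
      fix i assume "i \<in> {2..n} - {4..n}"
      then have "i = 2 \<or> i = 3" by auto
      then show "(B $ (i - 2)) *s e i = 0" by (auto simp: B0 B1)
    qed
  qed auto
  have split: "S.ser F = (\<Sum>i=2..n-1. (F $ (i - 2)) *s e i) + (F $ (n - 2)) *s e n" for F
    unfolding S.ser_def using assms(1) by (cases n) (simp_all add: numeral_2_eq_2)
  have "(\<Sum>i=2..n-1. (C $ (i - 2)) *s e i) = (\<Sum>t=3..n-1. (C $ (t - 2)) *s e t)"
    using assms(1) C0 by (subst sum.atLeast_Suc_atMost) (auto simp: numeral_3_eq_3)
  also have "\<dots> = (\<Sum>t=3..n-1. c t *s e t)"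
    by (intro sum.cong) (auto simp: C_nth)
  finally have mul_e1_x: "e 1 \<cdot> x = (\<Sum>t=3..n-1. c t *s e t) + (C $ (n - 2)) *s e n"
    by (simp only: C split)
  have "(\<Sum>i=2..n-1. (K $ (i - 2)) *s e i)
      = (\<Sum>i=2..n-2. (K $ (i - 2)) *s e i) + (K $ (n - 1 - 2)) *s e (n - 1)"
  proof -
    obtain m where "n = m + 4"
      using assms(1) by (metis le_add_diff_inverse2)
    then show ?thesis
      by (simp add: numeral_eq_Suc)
  qed
  also have "(\<Sum>i=2..n-2. (K $ (i - 2)) *s e i) = (\<Sum>i=2..n-2. (\<beta> (i + 2)
              + (\<Sum>j=3..i-1. \<alpha> j * (2 * \<beta> (i - j + 3)
                    + (\<Sum>r=3..i-j. \<alpha> r * \<beta> (i - j - r + 4))))) *s e i)"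
  proof (intro sum.cong refl arg_cong2[of _ _ _ _ scale])
    fix i assume "i \<in> {2..n-2}"
    then have i: "2 \<le> i" "i \<le> n - 1" "i + 1 \<le> n - 1"
      using assms(1) by auto
    have "C $ (i - 1) = c (i + 1)"
      using C_nth[of "i + 1"] i by simp
    also have "\<dots> = \<beta> (i + 2) + (\<Sum>j=3..i-1. \<alpha> j * \<beta> (i - j + 3))"
      by (rule c_plus_1)
    \<comment> \<open>The factor 2 in the final formula arises here: one copy of \<beta> (i - j + 3)
      comes from c (i + 1), the other from c (i - j + 2).\<close>
    finally have "K $ (i - 2) = \<beta> (i + 2)
        + (\<Sum>j=3..i-1. \<alpha> j * (\<beta> (i - j + 3) + c (i - j + 2)))"
      using K_nth[of i] i by (simp add: sum.distrib distrib_left)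
    also have "\<dots> = \<beta> (i + 2) + (\<Sum>j=3..i-1. \<alpha> j * (2 * \<beta> (i - j + 3)
                    + (\<Sum>r=3..i-j. \<alpha> r * \<beta> (i - j - r + 4))))"
      by (simp only: c_plus_2 mult_2 add.assoc)
    finally show "K $ (i - 2) = \<beta> (i + 2) + (\<Sum>j=3..i-1. \<alpha> j * (2 * \<beta> (i - j + 3)
                    + (\<Sum>r=3..i-j. \<alpha> r * \<beta> (i - j - r + 4))))" .
  qed
  also have "K $ (n - 1 - 2) = C $ (n - 2) + (\<Sum>i=3..n-2. \<alpha> i * (\<beta> (n - i + 2)
                    + (\<Sum>r=3..n-i-1. \<alpha> r * \<beta> (n - i - r + 3))))"
  proof -
    have "c (n - 1 - i + 2) = \<beta> (n - i + 2) + (\<Sum>r=3..n-i-1. \<alpha> r * \<beta> (n - i - r + 3))"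
      if "i \<in> {3..n-2}" for i
    proof -
      from that have "n - 1 - i + 2 = n - i + 1" by auto
      then show ?thesis by (simp only: c_plus_1)
    qed
    then show ?thesis
      using K_nth[of "n - 1"] assms(1) by (simp add: numeral_2_eq_2)
  qed
  finally have mul_x_x: "x \<cdot> x = (\<Sum>i=2..n-2. (\<beta> (i + 2)
              + (\<Sum>j=3..i-1. \<alpha> j * (2 * \<beta> (i - j + 3)
                    + (\<Sum>r=3..i-j. \<alpha> r * \<beta> (i - j - r + 4))))) *s e i)
          + (C $ (n - 2) + (\<Sum>i=3..n-2. \<alpha> i * (\<beta> (n - i + 2)
                    + (\<Sum>r=3..n-i-1. \<alpha> r * \<beta> (n - i - r + 3))))) *s e (n - 1)
          + (K $ (n - 2)) *s e n"
    by (simp only: K split)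
  have mul_e: "z \<cdot> e i = 0" if "2 \<le> i" "i \<le> n" for z i
    using zero[of z] S.ser_X_power[OF that] by metis
  have "e i \<cdot> e j = 0" if "i \<in> {1..n}" "j \<in> {1..n}" "(i, j) \<noteq> (1, 1)" for i j
  proof (cases "j = 1")
    case True
    then show ?thesis
      using that mul_e[of i "e 1"] T.mul_commute[of "e i" "e 1"] by auto
  next
    case False
    then show ?thesis
      using that mul_e[of j "e i"] by auto
  qed
  moreover have "e i \<cdot> x = 0" if "i \<in> {2..n}" for i
    using that mul_e[of i x] T.mul_commute[of "e i" x] by auto
  ultimately show ?thesis
    using mul_e1_e1 mul_e1_x[unfolded c_def] mul_x_x by blast
qed

end
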